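(* Let $\beta>0$ and $\alpha_1>\alpha_2>\dots>\alpha_m>0$ be given with $\alpha_1\in(0,2)$. Assume that $\alpha_1\pi/2<\mu<\min\{\alpha_1\pi,\pi\}$, $\mu\le|\arg(z_1)|\le\pi$, and that there exists $K>0$ such that $-K\le z_j<0$ for $j=2,\dots,m$. Then there exists a constant $C>0$ depending only on $\mu$, $K$, $\alpha_j$ ($j=1,\dots,m$) and $\beta$ such that $$\left|E_{(\alpha_1,\dots,\alpha_m),\beta}(z_1,\dots,z_m)\right|\le\frac{C}{1+|z_1|}.$$
   Context: Here $z_1\in\mathbb{C}$ and $z_2,\dots,z_m$ are real. The multinomial Mittag-Leffler function is $$E_{(\alpha_1,\dots,\alpha_m),\beta}(z_1,\dots,z_m)=\sum_{k=0}^\infty\ \sum_{\substack{k_1+\dots+k_m=k\\ k_j\ge0}}\binom{k}{k_1,\dots,k_m}\frac{\prod_{j=1}^m z_j^{k_j}}{\Gamma\left(\beta+\sum_{j=1}^m\alpha_jk_j\right)},$$ where $\binom{k}{k_1,\dots,k_m}$ is the multinomial coefficient. *)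

theory Defs
  imports "HOL-Analysis.Analysis"
begin

(* Parameters and arguments indexed by 1, ..., m are functions on nat of which only the
   values on {1..m} are used. *)

definition compositions :: "nat \<Rightarrow> nat \<Rightarrow> (nat \<Rightarrow> nat) set" where
  "compositions m k = {\<kappa> \<in> {1..m} \<rightarrow>\<^sub>E UNIV. (\<Sum>j=1..m. \<kappa> j) = k}"

definition multinomial_coeff :: "nat \<Rightarrow> nat \<Rightarrow> (nat \<Rightarrow> nat) \<Rightarrow> complex" where
  "multinomial_coeff m k \<kappa> = fact k / (\<Prod>j=1..m. fact (\<kappa> j))"

(* suminf is 0 on a divergent series; this one converges for all z when m is at least 1 and
   all alpha_j are positive. *)
definition multinomial_ML ::
    "nat \<Rightarrow> (nat \<Rightarrow> real) \<Rightarrow> real \<Rightarrow> (nat \<Rightarrow> complex) \<Rightarrow> complex" where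
  "multinomial_ML m \<alpha> \<beta> z =
     (\<Sum>k. \<Sum>\<kappa>\<in>compositions m k.
        multinomial_coeff m k \<kappa> * (\<Prod>j=1..m. z j ^ \<kappa> j) /
          of_real (Gamma (\<beta> + (\<Sum>j=1..m. \<alpha> j * real (\<kappa> j)))))"

lemma finite_compositions: "finite (compositions m k)"
proof (rule finite_subset)
  show "compositions m k \<subseteq> {1..m} \<rightarrow>\<^sub>E {..k}"
  proof
    fix \<kappa> assume \<kappa>: "\<kappa> \<in> compositions m k"
    have "\<kappa> j \<le> k" if "j \<in> {1..m}" for j
      using \<kappa> member_le_sum[of j "{1..m}" \<kappa>] that by (simp add: compositions_def)
    then show "\<kappa> \<in> {1..m} \<rightarrow>\<^sub>E {..k}"
      using \<kappa> by (auto simp: compositions_def PiE_iff)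
  qed
  show "finite ({1..m} \<rightarrow>\<^sub>E {..k})"
    by (intro finite_PiE) auto
qed

end

theory Submission
  imports Defs "HOL-Complex_Analysis.Cauchy_Integral_Theorem" "HOL-Real_Asymp.Real_Asymp"
begin

text \<open>
Hankel's formula writes \<open>1 / \<Gamma>(x)\<close> as the integral of \<open>exp s * s powr (- x) / (2 \<pi> \<i>)\<close> over a contour that
comes in from infinity along the ray \<open>arg s = - \<theta>\<close>, passes around the origin and leaves along
\<open>arg s = \<theta>\<close>, with \<open>\<pi> / 2 < \<theta>\<close>. Inserted in the Mittag-Leffler series it turns the inner sums,
by the multinomial theorem, into the powers of \<open>\<Sum>\<^sub>j z j * s powr (- \<alpha> j)\<close>, and hence
\[ E(z) = \frac{1}{2\pi i}\int \frac{e^s s^{\alpha_1-\beta}}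
     {s^{\alpha_1} - z_1 - \sum_{j\ge2} z_j s^{\alpha_1-\alpha_j}}\,ds. \]
This is first true where the geometric series converges, that is far from the origin, how far
depending on \<open>z\<close>. The contour can then be pulled in to the unit circle, independently of \<open>z\<close>, if the denominator does
not vanish on the way.

It does not vanish because of phases alone. For \<open>\<bar>arg s\<bar> \<le> \<theta> < \<mu> / \<alpha>\<^sub>1\<close> the terms \<open>s powr \<alpha>\<^sub>1\<close> and
\<open>- z j * s powr (\<alpha>\<^sub>1 - \<alpha> j)\<close> for \<open>j \<ge> 2\<close>, where \<open>z j < 0\<close>, lie in one convex cone bounded by the directions \<open>0\<close> and
\<open>\<alpha>\<^sub>1 * arg s\<close>, while
\<open>z 1\<close> stays at a positive angle from this cone. A linear functional that separates the two
shows that the denominator is at least a constant times \<open>\<bar>s\<bar> powr \<alpha>\<^sub>1 + \<bar>z 1\<bar>\<close>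
(\<open>ml_symbol_lower_bound\<close>). On the contour this is at least a constant times \<open>1 + \<bar>z 1\<bar>\<close>, and the
rest of the integrand is integrable since \<open>cos \<theta> < 0\<close>.

Everything is carried out in the variable \<open>u\<close> with \<open>s = exp u\<close>. Sectors become horizontal strips,
powers become exponentials without branch cuts, and the arc of radius \<open>exp T\<close> becomes a vertical
chord. A strip is convex, so the holomorphic integrand has a primitive, and its integral along any
path is a difference of two values of the primitive. Changing the contour is then just telescoping
such differences, each estimated by the mean value inequality (\<open>chord_increment_bound\<close>), and
integrals over unbounded contours are limits as \<open>T\<close> grows. In these terms Hankel's formula is
\<open>hankel_arc_limit\<close> and the representation of \<open>E\<close> is \<open>multinomial_ML_limit_chord_increment\<close>.
\<close>

section \<open>Increments of primitives in a horizontal strip\<close>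

text \<open>In the logarithmic plane a circular arc of radius \<open>exp T\<close> and opening \<open>2 * \<theta>\<close> becomes the vertical
chord from \<open>T - \<i> * \<theta>\<close> to \<open>T + \<i> * \<theta>\<close>. When \<open>F\<close> is a primitive of \<open>f\<close> on a strip, the increment below is the
integral of \<open>f\<close> along this chord, and also along any other path in the strip with the same end
points.\<close>

definition chord_increment :: "(complex \<Rightarrow> complex) \<Rightarrow> real \<Rightarrow> real \<Rightarrow> complex" where
  "chord_increment F \<theta> T = F (of_real T + \<i> * of_real \<theta>) - F (of_real T - \<i> * of_real \<theta>)"

lemma vertical_increment_bound:
  fixes F f :: "complex \<Rightarrow> complex"
  assumes "a \<le> b"
    and deriv: "\<And>y. a \<le> y \<Longrightarrow> y \<le> b \<Longrightarrow>
      (F has_field_derivative f (of_real T + \<i> * of_real y)) (at (of_real T + \<i> * of_real y))"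
    and bound: "\<And>y. a \<le> y \<Longrightarrow> y \<le> b \<Longrightarrow> norm (f (of_real T + \<i> * of_real y)) \<le> V"
  shows "norm (F (of_real T + \<i> * of_real b) - F (of_real T + \<i> * of_real a)) \<le> V * (b - a)"
proof -
  define S where "S = closed_segment (of_real T + \<i> * of_real b) (of_real T + \<i> * of_real a)"
  have S: "\<exists>y. a \<le> y \<and> y \<le> b \<and> u = of_real T + \<i> * of_real y" if "u \<in> S" for u
  proof -
    from that obtain t where t: "0 \<le> t" "t \<le> 1"
      and u: "u = (1 - t) *\<^sub>R (of_real T + \<i> * of_real b) + t *\<^sub>R (of_real T + \<i> * of_real a)"
      by (auto simp: S_def closed_segment_def)
    have "u = of_real T + \<i> * of_real ((1 - t) * b + t * a)"
      unfolding u by (simp add: complex_eq_iff algebra_simps)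
    moreover have "a \<le> (1 - t) * b + t * a"
    proof -
      have "0 \<le> (1 - t) * (b - a)" using t \<open>a \<le> b\<close> by simp
      then show ?thesis by (simp add: algebra_simps)
    qed
    moreover have "(1 - t) * b + t * a \<le> b"
    proof -
      have "0 \<le> t * (b - a)" using t \<open>a \<le> b\<close> by simp
      then show ?thesis by (simp add: algebra_simps)
    qed
    ultimately show ?thesis by blast
  qed
  have "norm (F (of_real T + \<i> * of_real b) - F (of_real T + \<i> * of_real a))
      \<le> V * norm ((of_real T + \<i> * of_real b) - (of_real T + \<i> * of_real a))"
  proof (rule field_differentiable_bound[where S = S and f' = f])
    fix u assume "u \<in> S"
    then obtain y where y: "a \<le> y" "y \<le> b" "u = of_real T + \<i> * of_real y" using S by blast
    show "(F has_field_derivative f u) (at u within S)"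
      using deriv[OF y(1,2)] y(3) by (simp add: has_field_derivative_at_within)
    show "norm (f u) \<le> V" using bound[OF y(1,2)] y(3) by simp
  qed (auto simp: S_def)
  also have "(of_real T + \<i> * of_real b) - (of_real T + \<i> * of_real a) = \<i> * of_real (b - a)"
    by (simp add: algebra_simps)
  also have "norm \<dots> = b - a" using \<open>a \<le> b\<close> by (simp only: norm_mult norm_of_real) simp
  finally show ?thesis .
qed

text \<open>The majorant \<open>exp t * exp (- c * exp t)\<close> is the derivative of \<open>- exp (- c * exp t) / c\<close>, whose total
variation is at most \<open>1 / c\<close>; so the bound does not see how far to the right the path goes.\<close>

lemma horizontal_increment_bound:
  fixes F f :: "complex \<Rightarrow> complex"
  assumes "a \<le> T" "0 < c" "0 \<le> M"
    and deriv: "\<And>t. a \<le> t \<Longrightarrow> (F has_field_derivative f (of_real t + v)) (at (of_real t + v))"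
    and bound: "\<And>t. a \<le> t \<Longrightarrow> norm (f (of_real t + v)) \<le> M * (exp t * exp (- c * exp t))"
  shows "norm (F (of_real T + v) - F (of_real a + v)) \<le> M / c"
proof (cases "a = T")
  case False
  then have "a < T" using assms by simp
  have vd: "((\<lambda>t. F (of_real t + v)) has_vector_derivative f (of_real t + v)) (at t)"
    if "a \<le> t" for t
  proof -
    have "((\<lambda>t. of_real t + v) has_vector_derivative 1) (at t)"
      by (auto intro!: derivative_eq_intros)
    from field_vector_diff_chain_at[OF this deriv[OF that]] show ?thesis by (simp add: o_def)
  qed
  have "norm (F (of_real T + v) - F (of_real a + v))
      \<le> - M / c * exp (- c * exp T) - (- M / c * exp (- c * exp a))"
  proof (rule differentiable_bound_general[OF \<open>a < T\<close>,
        where f = "\<lambda>t. F (of_real t + v)" and \<phi> = "\<lambda>t. - M / c * exp (- c * exp t)"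
        and f' = "\<lambda>t. f (of_real t + v)" and \<phi>' = "\<lambda>t. M * (exp t * exp (- c * exp t))"])
    show "continuous_on {a..T} (\<lambda>t. F (of_real t + v))"
      by (rule continuous_at_imp_continuous_on)
        (auto intro: has_vector_derivative_continuous[OF vd])
    show "((\<lambda>t. - M / c * exp (- c * exp t)) has_vector_derivative
        M * (exp t * exp (- c * exp t))) (at t)" for t
      using \<open>0 < c\<close> unfolding has_real_derivative_iff_has_vector_derivative[symmetric]
      by (auto intro!: derivative_eq_intros)
  qed (use vd bound \<open>0 < c\<close> in \<open>auto intro!: continuous_intros\<close>)
  also have "\<dots> \<le> M / c * exp (- c * exp a)"
    using assms by simp
  also have "\<dots> \<le> M / c"
    using assms by (intro mult_left_le) auto
  finally show ?thesis .
qed (use assms in simp)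

text \<open>This is the change of contour. Going from one end of the chord to the other by way of the left
edge \<open>Re u = a\<close> and the two horizontal sides gives a bound uniform in \<open>T\<close>.\<close>

lemma chord_increment_bound:
  fixes F f :: "complex \<Rightarrow> complex"
  assumes "a \<le> T" "0 \<le> \<theta>" "0 < c" "0 \<le> M"
    and deriv: "\<And>u. a \<le> Re u \<Longrightarrow> \<bar>Im u\<bar> \<le> \<theta> \<Longrightarrow> (F has_field_derivative f u) (at u)"
    and vertical: "\<And>u. Re u = a \<Longrightarrow> \<bar>Im u\<bar> \<le> \<theta> \<Longrightarrow> norm (f u) \<le> V"
    and horizontal: "\<And>u. a \<le> Re u \<Longrightarrow> \<bar>Im u\<bar> = \<theta> \<Longrightarrow>
      norm (f u) \<le> M * (exp (Re u) * exp (- c * exp (Re u)))"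
  shows "norm (chord_increment F \<theta> T) \<le> 2 * \<theta> * V + 2 * M / c"
proof -
  let ?p = "\<lambda>t. of_real t + \<i> * of_real \<theta>" and ?m = "\<lambda>t. of_real t + (- \<i> * of_real \<theta>)"
  have top: "norm (F (?p T) - F (?p a)) \<le> M / c"
    using assms by (intro horizontal_increment_bound[where f = f] deriv order_trans[OF horizontal]) auto
  have bottom: "norm (F (?m T) - F (?m a)) \<le> M / c"
    using assms by (intro horizontal_increment_bound[where f = f] deriv order_trans[OF horizontal]) auto
  have left: "norm (F (?p a) - F (?m a)) \<le> V * (2 * \<theta>)"
    using vertical_increment_bound[of "-\<theta>" \<theta> F f a V] assms by simp
  have "chord_increment F \<theta> T = (F (?p T) - F (?p a)) + (F (?p a) - F (?m a)) - (F (?m T) - F (?m a))"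
    by (simp add: chord_increment_def)
  then have "norm (chord_increment F \<theta> T)
      \<le> norm (F (?p T) - F (?p a)) + norm (F (?p a) - F (?m a)) + norm (F (?m T) - F (?m a))"
    by (simp only:) (intro norm_triangle_le_diff add_mono order_refl norm_triangle_ineq)
  moreover have "2 * M / c = M / c + M / c" by simp
  moreover have "2 * \<theta> * V = V * (2 * \<theta>)" by simp
  ultimately show ?thesis using top bottom left by linarith
qed

section \<open>Hankel's formula for the reciprocal Gamma function\<close>

text \<open>Hankel's integrand \<open>exp s * s powr (-x) ds\<close> after the substitution \<open>s = exp u\<close>. It is entire in \<open>u\<close>.\<close>

definition hankel :: "real \<Rightarrow> complex \<Rightarrow> complex" where
  "hankel x u = exp (exp u) * exp ((1 - of_real x) * u)"

lemma norm_hankel: "norm (hankel x u) = exp (exp (Re u) * cos (Im u)) * exp ((1 - x) * Re u)"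
  by (simp add: hankel_def norm_mult Re_exp)

definition hankel_primitive :: "real \<Rightarrow> complex \<Rightarrow> complex" where
  "hankel_primitive x = (SOME F. \<forall>u. (F has_field_derivative hankel x u) (at u))"

lemma hankel_primitive: "(hankel_primitive x has_field_derivative hankel x u) (at u)"
proof -
  have "hankel x holomorphic_on UNIV"
    unfolding hankel_def by (intro holomorphic_intros)
  then have "\<exists>F. \<forall>u. (F has_field_derivative hankel x u) (at u)"
    using holomorphic_convex_primitive'[of UNIV "hankel x"] by (metis UNIV_I convex_UNIV open_UNIV)
  from someI_ex[OF this] show ?thesis
    unfolding hankel_primitive_def by blast
qed

text \<open>The part of Hankel's integral over the arc of radius \<open>exp T\<close>; equivalently Hankel's contour cut off
at radius \<open>exp T\<close>.\<close>

definition hankel_arc :: "real \<Rightarrow> real \<Rightarrow> real \<Rightarrow> complex" where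
  "hankel_arc \<theta> x T = chord_increment (hankel_primitive x) \<theta> T / (2 * of_real pi * \<i>)"

text \<open>The norm of the integrand depends on \<open>x\<close> only through the factor \<open>exp (- x * Re u)\<close>, which is at most
\<open>exp (- x * T0)\<close> on the path through the left edge \<open>Re u = T0\<close>. The decay in \<open>x\<close> is what later dominates the
Mittag-Leffler series.\<close>

lemma hankel_arc_bound:
  assumes "pi / 2 < \<theta>" "\<theta> \<le> pi"
  obtains C where "C > 0" "\<And>x T. 0 \<le> x \<Longrightarrow> T0 \<le> T \<Longrightarrow> norm (hankel_arc \<theta> x T) \<le> C * exp (- x * T0)"
proof -
  have c: "cos \<theta> < 0"
    using assms by (intro cos_lt_zero_pi) auto
  define V where "V = exp (exp T0) * exp T0"
  define C where "C = (2 * \<theta> * V + 2 / (- cos \<theta>)) / (2 * pi)"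
  have "norm (hankel_arc \<theta> x T) \<le> C * exp (- x * T0)" if "0 \<le> x" "T0 \<le> T" for x T
  proof -
    have "norm (chord_increment (hankel_primitive x) \<theta> T)
        \<le> 2 * \<theta> * (V * exp (- x * T0)) + 2 * exp (- x * T0) / (- cos \<theta>)"
    proof (rule chord_increment_bound[where a = T0 and f = "hankel x"])
      fix u :: complex assume u: "Re u = T0" "\<bar>Im u\<bar> \<le> \<theta>"
      have "exp (exp T0 * cos (Im u)) \<le> exp (exp T0)" by simp
      then have "norm (hankel x u) \<le> exp (exp T0) * exp ((1 - x) * T0)"
        by (simp add: norm_hankel u)
      also have "\<dots> = V * exp (- x * T0)"
        by (simp add: V_def flip: exp_add) (simp add: algebra_simps)
      finally show "norm (hankel x u) \<le> V * exp (- x * T0)" .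
    next
      fix u :: complex assume u: "T0 \<le> Re u" "\<bar>Im u\<bar> = \<theta>"
      then have "cos (Im u) = cos \<theta>" by (metis cos_abs_real)
      then have "norm (hankel x u) = exp (- x * Re u) * (exp (Re u) * exp (- (- cos \<theta>) * exp (Re u)))"
        by (simp add: norm_hankel algebra_simps flip: exp_add)
      also have "\<dots> \<le> exp (- x * T0) * (exp (Re u) * exp (- (- cos \<theta>) * exp (Re u)))"
        using u that by (intro mult_right_mono) (auto intro: mult_left_mono)
      finally show "norm (hankel x u)
        \<le> exp (- x * T0) * (exp (Re u) * exp (- (- cos \<theta>) * exp (Re u)))" .
    qed (use that assms c hankel_primitive in auto)
    also have "\<dots> = 2 * pi * (C * exp (- x * T0))"
      by (simp add: C_def field_simps)
    finally show ?thesis by (simp add: hankel_arc_def norm_divide norm_mult field_simps)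
  qed
  moreover have "C > 0"
  proof -
    have "2 * \<theta> * V > 0" using assms pi_gt_zero by (auto simp: V_def)
    moreover have "2 / (- cos \<theta>) > 0" using c by (intro divide_pos_pos) auto
    ultimately show ?thesis unfolding C_def by (intro divide_pos_pos add_pos_pos) auto
  qed
  ultimately show ?thesis using that by blast
qed

text \<open>Between the angles \<open>\<theta>\<close> and \<open>pi\<close> the cosine is bounded by \<open>cos \<theta> < 0\<close>, so the integrand decays doubly
exponentially there. Hence Hankel's formula need only be proved for the full circle.\<close>

lemma hankel_arc_transfer:
  assumes "pi / 2 < \<theta>" "\<theta> \<le> pi"
  shows "((\<lambda>T. hankel_arc \<theta> x T - hankel_arc pi x T) \<longlongrightarrow> 0) at_top"
proof -
  have c: "cos \<theta> < 0"
    using assms by (intro cos_lt_zero_pi) auto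
  define B where "B T = exp (exp T * cos \<theta>) * exp ((1 - x) * T)" for T
  have small: "norm (hankel x u) \<le> B T" if "Re u = T" "\<theta> \<le> \<bar>Im u\<bar>" "\<bar>Im u\<bar> \<le> pi" for u T
  proof -
    have "cos (Im u) \<le> cos \<theta>"
      using that assms cos_mono_le_eq[of "\<bar>Im u\<bar>" \<theta>] pi_gt_zero by (simp del: pi_gt_zero)
    then show ?thesis by (simp add: norm_hankel B_def that)
  qed
  let ?F = "hankel_primitive x"
  have "norm (hankel_arc \<theta> x T - hankel_arc pi x T) \<le> B T" for T
  proof -
    have up: "norm (?F (of_real T + \<i> * of_real pi) - ?F (of_real T + \<i> * of_real \<theta>)) \<le> B T * (pi - \<theta>)"
      by (rule vertical_increment_bound[where f = "hankel x"])
         (use assms pi_gt_zero in \<open>auto intro!: small hankel_primitive simp del: pi_gt_zero\<close>)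
    have down: "norm (?F (of_real T + \<i> * of_real (-\<theta>)) - ?F (of_real T + \<i> * of_real (-pi)))
        \<le> B T * ((-\<theta>) - (- pi))"
      by (rule vertical_increment_bound[where f = "hankel x"])
         (use assms pi_gt_zero in \<open>auto intro!: small hankel_primitive simp del: pi_gt_zero\<close>)
    have "chord_increment ?F pi T - chord_increment ?F \<theta> T =
       (?F (of_real T + \<i> * of_real pi) - ?F (of_real T + \<i> * of_real \<theta>)) +
       (?F (of_real T + \<i> * of_real (-\<theta>)) - ?F (of_real T + \<i> * of_real (-pi)))"
      by (simp add: chord_increment_def)
    then have "norm (chord_increment ?F pi T - chord_increment ?F \<theta> T) \<le> B T * (pi - \<theta>) + B T * (pi - \<theta>)"
      using norm_triangle_le[OF add_mono[OF up down]] by simp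
    also have "\<dots> \<le> B T * (2 * pi)"
      using assms pi_gt_zero by (simp add: B_def algebra_simps del: pi_gt_zero)
    finally have "norm (chord_increment ?F \<theta> T - chord_increment ?F pi T) \<le> B T * (2 * pi)"
      by (simp add: norm_minus_commute)
    then have "norm (chord_increment ?F \<theta> T - chord_increment ?F pi T) / (2 * pi) \<le> B T"
      by (simp add: field_simps)
    then show ?thesis
      by (simp add: hankel_arc_def norm_divide norm_mult flip: diff_divide_distrib)
  qed
  moreover have "(B \<longlongrightarrow> 0) at_top"
    unfolding B_def using c by real_asymp
  ultimately show ?thesis
    by (rule Lim_null_comparison[OF always_eventually[OF allI]])
qed

text \<open>Integration by parts, \<open>d/du (exp (exp u) * exp (- x * u)) = hankel x u - x * hankel (x + 1) u\<close>; the
boundary terms vanish as \<open>T\<close> grows. The limit therefore obeys the functional equation of \<open>rGamma\<close>.\<close>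

lemma hankel_arc_recurrence:
  "((\<lambda>T. hankel_arc pi x T - of_real x * hankel_arc pi (x + 1) T) \<longlongrightarrow> 0) at_top"
proof -
  define h where "h u = exp (exp u) * exp (- of_real x * u)" for u :: complex
  define E where "E u = hankel_primitive x u - of_real x * hankel_primitive (x + 1) u - h u" for u
  have "(E has_field_derivative 0) (at u)" for u
    unfolding E_def h_def
    by (rule derivative_eq_intros hankel_primitive refl)+
       (simp add: hankel_def algebra_simps flip: exp_add)
  then obtain k where k: "\<And>u. E u = k"
    using has_field_derivative_zero_constant[of UNIV E] by auto
  have "hankel_arc pi x T - of_real x * hankel_arc pi (x + 1) T = chord_increment h pi T / (2 * of_real pi * \<i>)" for T
  proof -
    have "chord_increment (hankel_primitive x) pi T - of_real x * chord_increment (hankel_primitive (x + 1)) pi T = chord_increment h pi T"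
      using k[of "of_real T + \<i> * of_real pi"] k[of "of_real T - \<i> * of_real pi"]
      by (simp add: chord_increment_def E_def algebra_simps)
    then show ?thesis
      by (simp add: hankel_arc_def field_simps)
  qed
  moreover have "((\<lambda>T. chord_increment h pi T / (2 * of_real pi * \<i>)) \<longlongrightarrow> 0) at_top"
  proof (rule Lim_null_comparison[OF always_eventually[OF allI]])
    fix T
    have "norm (h u) = exp (- exp T) * exp (- x * T)" if "Re u = T" "\<bar>Im u\<bar> = pi" for u
    proof -
      have "cos (Im u) = -1" using that by (metis cos_abs_real cos_pi)
      then show ?thesis using that by (simp add: h_def norm_mult Re_exp)
    qed
    then have "norm (chord_increment h pi T) \<le> exp (- exp T) * exp (- x * T) + exp (- exp T) * exp (- x * T)"
      unfolding chord_increment_def by (intro norm_triangle_le_diff add_mono) auto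
    then show "norm (chord_increment h pi T / (2 * of_real pi * \<i>)) \<le> exp (- exp T) * exp (- x * T) / pi"
      by (simp add: norm_divide norm_mult field_simps)
  next
    show "((\<lambda>T. exp (- exp T) * exp (- x * T) / pi) \<longlongrightarrow> 0) at_top"
      by real_asymp
  qed
  ultimately show ?thesis by simp
qed

text \<open>Moving the chord changes the integral only by the values of the integrand at the two ends. At
height \<open>pi\<close> both ends lie over the negative axis, where the two branches of the power combine to a
sine.\<close>

lemma hankel_arc_pi_derivative:
  "(hankel_arc pi x has_vector_derivative
      of_real (sin (pi * x) / pi * (exp (- exp T) * exp ((1 - x) * T)))) (at T)"
proof -
  let ?F = "hankel_primitive x"
  let ?p = "\<lambda>t. of_real t + \<i> * of_real pi" and ?m = "\<lambda>t. of_real t - \<i> * of_real pi"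
  have p: "((\<lambda>t. ?F (?p t)) has_vector_derivative hankel x (?p T)) (at T)"
  proof -
    have "(?p has_vector_derivative 1) (at T)" by (auto intro!: derivative_eq_intros)
    from field_vector_diff_chain_at[OF this hankel_primitive] show ?thesis by (simp add: o_def)
  qed
  have m: "((\<lambda>t. ?F (?m t)) has_vector_derivative hankel x (?m T)) (at T)"
  proof -
    have "(?m has_vector_derivative 1) (at T)" by (auto intro!: derivative_eq_intros)
    from field_vector_diff_chain_at[OF this hankel_primitive] show ?thesis by (simp add: o_def)
  qed
  have val: "hankel x (of_real T + \<i> * of_real (s * pi))
      = of_real (exp (- exp T) * exp ((1 - x) * T)) * cis (s * (pi * (1 - x)))" if "s = 1 \<or> s = -1" for s
  proof -
    have "exp (of_real T + \<i> * of_real (s * pi)) = of_real (- exp T)"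
      using that by (auto simp: exp_add exp_of_real cis_conv_exp[symmetric] cis_pi exp_minus)
    then show ?thesis
      by (simp add: hankel_def cis_conv_exp algebra_simps exp_of_real[symmetric] flip: exp_add)
  qed
  have "(hankel_arc pi x has_vector_derivative
      (hankel x (?p T) - hankel x (?m T)) / (2 * of_real pi * \<i>)) (at T)"
    unfolding hankel_arc_def chord_increment_def
    by (intro has_vector_derivative_divide has_vector_derivative_diff p m)
  also have "(hankel x (?p T) - hankel x (?m T)) / (2 * of_real pi * \<i>) =
      of_real (sin (pi * x) / pi * (exp (- exp T) * exp ((1 - x) * T)))"
  proof -
    have "sin (pi * (1 - x)) = sin (pi * x)"
      by (simp add: right_diff_distrib sin_diff)
    then have "cis (1 * (pi * (1 - x))) - cis ((-1) * (pi * (1 - x))) = 2 * \<i> * of_real (sin (pi * x))"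
      by (simp add: complex_eq_iff)
    then have "hankel x (?p T) - hankel x (?m T) =
       of_real (exp (- exp T) * exp ((1 - x) * T)) * (2 * \<i> * of_real (sin (pi * x)))"
      using val[of 1] val[of "-1"] by (simp flip: right_diff_distrib)
    then show ?thesis by simp
  qed
  finally show ?thesis .
qed

lemma lower_incomplete_Gamma_limit:
  assumes "s > (0::real)"
  shows "((\<lambda>R. integral {0..R} (\<lambda>t. t powr (s - 1) / exp t)) \<longlongrightarrow> Gamma s) at_top"
proof (rule tendstoI)
  fix e :: real assume "e > 0"
  define f where "f t = t powr (s - 1) / exp t" for t :: real
  have "(f has_integral Gamma s) {0..}"
    unfolding f_def using Gamma_integral_real[OF assms] .
  then obtain B where B: "B > 0" "\<And>a b. ball 0 B \<subseteq> cbox a b \<Longrightarrow>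
      norm (integral (cbox a b) (\<lambda>x. if x \<in> {0..} then f x else 0) - Gamma s) < e"
    unfolding has_integral_alt'[of f] using \<open>e > 0\<close> by blast
  have "dist (integral {0..R} f) (Gamma s) < e" if "R \<ge> B" for R
  proof -
    have "ball 0 B \<subseteq> cbox (-R) R"
      using that by (auto simp: dist_norm)
    moreover have "integral (cbox (-R) R) (\<lambda>x. if x \<in> {0..} then f x else 0) = integral {0..R} f"
    proof -
      have "{0..} \<inter> {-R..R} = {0..R}" using that \<open>B > 0\<close> by auto
      then show ?thesis
        by (simp only: integral_restrict_Int cbox_interval Int_commute)
    qed
    ultimately show ?thesis using B(2)[of "-R" R] by (simp add: dist_norm)
  qed
  then have "eventually (\<lambda>R. dist (integral {0..R} f) (Gamma s) < e) at_top"
    unfolding eventually_at_top_linorder by blast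
  then show "eventually (\<lambda>R. dist (integral {0..R} (\<lambda>t. t powr (s - 1) / exp t)) (Gamma s) < e) at_top"
    by (simp add: f_def[abs_def])
qed

lemma lower_incomplete_Gamma_integrable:
  assumes "s > (0::real)"
  shows "(\<lambda>t. t powr (s - 1) / exp t) integrable_on {0..R}"
proof -
  have "(\<lambda>t. t powr (s - 1) / exp t) integrable_on {0..}"
    using Gamma_integral_real[OF assms] by blast
  then show ?thesis
    by (rule integrable_on_subinterval) auto
qed

lemma norm_exp_diff_1_le: "norm (exp z - 1) \<le> exp (norm z) * norm (z :: complex)"
proof -
  have "norm (exp z - exp 0) \<le> exp (norm z) * norm (z - 0)"
  proof (rule field_differentiable_bound[of "cball 0 (norm z)" exp exp])
    fix w :: complex assume "w \<in> cball 0 (norm z)"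
    then have "Re w \<le> norm z" using complex_Re_le_cmod[of w] by simp
    then show "norm (exp w) \<le> exp (norm z)" by simp
  qed (auto intro: DERIV_exp has_field_derivative_at_within)
  then show ?thesis by simp
qed

text \<open>For \<open>x < 1\<close> the integrand vanishes as the circle shrinks to the origin. For \<open>x = 1\<close> it tends to \<open>1\<close>,
and the chord has length \<open>2 * pi\<close>.\<close>

lemma hankel_arc_pi_at_bot:
  assumes "x \<le> 1"
  shows "((\<lambda>T. hankel_arc pi x T) \<longlongrightarrow> (if x = 1 then 1 else 0)) at_bot"
proof (cases "x = 1")
  case True
  define G where "G u = hankel_primitive x u - u" for u
  have "norm (hankel_arc pi x T - 1) \<le> exp (exp T) * exp T" for T
  proof -
    have "norm (G (of_real T + \<i> * of_real pi) - G (of_real T + \<i> * of_real (-pi)))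
      \<le> exp (exp T) * exp T * (pi - (-pi))"
    proof (rule vertical_increment_bound)
      fix y
      let ?u = "of_real T + \<i> * of_real y :: complex"
      show "(G has_field_derivative (exp (exp ?u) - 1)) (at ?u)"
        unfolding G_def using True
        by (auto intro!: derivative_eq_intros hankel_primitive simp: hankel_def)
      have "norm (exp (exp ?u) - 1) \<le> exp (norm (exp ?u)) * norm (exp ?u)"
        by (rule norm_exp_diff_1_le)
      then show "norm (exp (exp ?u) - 1) \<le> exp (exp T) * exp T"
        by simp
    qed auto
    moreover have "G (of_real T + \<i> * of_real pi) - G (of_real T + \<i> * of_real (-pi))
       = (hankel_arc pi x T - 1) * (2 * of_real pi * \<i>)"
      by (simp add: G_def hankel_arc_def chord_increment_def field_simps)
    ultimately show ?thesis by (simp add: norm_mult)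
  qed
  moreover have "((\<lambda>T. exp (exp T) * exp T) \<longlongrightarrow> (0::real)) at_bot"
    by real_asymp
  ultimately have "((\<lambda>T. hankel_arc pi x T - 1) \<longlongrightarrow> 0) at_bot"
    by (rule Lim_null_comparison[OF always_eventually[OF allI]])
  then show ?thesis using True by (simp add: LIM_zero_iff)
next
  case False
  have "norm (hankel_arc pi x T) \<le> exp (exp T) * exp ((1 - x) * T)" for T
  proof -
    let ?F = "hankel_primitive x"
    have "norm (?F (of_real T + \<i> * of_real pi) - ?F (of_real T + \<i> * of_real (-pi)))
      \<le> exp (exp T) * exp ((1 - x) * T) * (pi - (-pi))"
      by (rule vertical_increment_bound[where f = "hankel x"])
         (auto intro!: hankel_primitive simp: norm_hankel)
    then show ?thesis
      by (simp add: hankel_arc_def chord_increment_def norm_divide norm_mult field_simps)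
  qed
  moreover have "((\<lambda>T. exp (exp T) * exp ((1 - x) * T)) \<longlongrightarrow> 0) at_bot"
  proof -
    define d where "d = 1 - x"
    have "d > 0" using assms False by (simp add: d_def)
    then show ?thesis unfolding d_def[symmetric] by real_asymp
  qed
  ultimately show ?thesis using False
    using Lim_null_comparison[OF always_eventually[OF allI]] by fastforce
qed

text \<open>By its derivative and its limit at the origin, for \<open>x < 1\<close> the full circle integral is
\<open>sin (pi * x) / pi\<close> times the lower incomplete Gamma function of \<open>1 - x\<close>, so that the reflection
formula gives the limit. For \<open>x = 1\<close> the derivative vanishes and the integral is constantly \<open>1\<close>. The
two cases cover a full period of the recurrence.\<close>

lemma hankel_arc_pi_limit_le_1:
  assumes "0 < x" "x \<le> 1"
  shows "((\<lambda>T. hankel_arc pi x T) \<longlongrightarrow> of_real (rGamma x)) at_top"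
proof (cases "x = 1")
  case True
  have "(hankel_arc pi x has_vector_derivative 0) (at T)" for T
    using hankel_arc_pi_derivative[of x T] True by simp
  then obtain k where k: "\<And>T. hankel_arc pi x T = k"
    using has_vector_derivative_zero_constant[of UNIV "hankel_arc pi x"] by auto
  then have arc: "hankel_arc pi x = (\<lambda>_. k)" by blast
  have "k = 1"
    using hankel_arc_pi_at_bot[of x] True unfolding arc by (simp add: tendsto_const_iff)
  then show ?thesis unfolding arc using True by simp
next
  case False
  define s where "s = 1 - x"
  have s: "0 < s" "s < 1" using assms False by (auto simp: s_def)
  define f where "f t = t powr (s - 1) / exp t" for t :: real
  define \<gamma> where "\<gamma> R = integral {0..R} f" for R
  define c where "c = sin (pi * x) / pi"
  define E where "E T = hankel_arc pi x T - of_real (c * \<gamma> (exp T))" for T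
  have "(E has_vector_derivative 0) (at T)" for T
  proof -
    have "(\<gamma> has_vector_derivative f (exp T)) (at (exp T) within {0..exp T + 1} - {})"
      unfolding \<gamma>_def
    proof (rule integral_has_vector_derivative_continuous_at)
      show "f integrable_on {0..exp T + 1}"
        using lower_incomplete_Gamma_integrable[OF s(1)] by (simp add: f_def[abs_def])
      show "continuous (at (exp T) within {0..exp T + 1} - {}) f"
        unfolding f_def by (intro continuous_intros) auto
    qed auto
    then have "(\<gamma> has_real_derivative f (exp T)) (at (exp T) within {0..exp T + 1})"
      by (simp add: has_real_derivative_iff_has_vector_derivative)
    then have "(\<gamma> has_real_derivative f (exp T)) (at (exp T))"
      by (subst (asm) at_within_interior) auto
    then have "((\<lambda>T. c * \<gamma> (exp T)) has_real_derivative c * (f (exp T) * exp T)) (at T)"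
      by (auto intro!: derivative_eq_intros DERIV_chain2[where f = \<gamma>])
    then have "((\<lambda>T. of_real (c * \<gamma> (exp T)) :: complex) has_vector_derivative of_real (c * (f (exp T) * exp T))) (at T)"
      by (rule has_vector_derivative_of_real)
    moreover have "f (exp T) * exp T = exp (- exp T) * exp ((1 - x) * T)"
      by (simp add: f_def s_def powr_def exp_minus field_simps flip: exp_add)
    ultimately show ?thesis
      unfolding E_def using has_vector_derivative_diff[OF hankel_arc_pi_derivative[of x T]]
      by (fastforce simp: c_def)
  qed
  then obtain k where k: "\<And>T. E T = k"
    using has_vector_derivative_zero_constant[of UNIV E] by auto
  have "(E \<longlongrightarrow> 0 - of_real (c * 0)) at_bot"
    unfolding E_def
  proof (intro tendsto_intros)
    show "((\<lambda>T. hankel_arc pi x T) \<longlongrightarrow> 0) at_bot"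
      using hankel_arc_pi_at_bot[of x] assms False by simp
    have "continuous_on {0..1} \<gamma>"
      unfolding \<gamma>_def
      by (rule indefinite_integral_continuous_1)
        (use lower_incomplete_Gamma_integrable[OF s(1)] in \<open>simp add: f_def[abs_def]\<close>)
    then have "(\<gamma> \<longlongrightarrow> \<gamma> 0) (at 0 within {0..1})"
      by (simp add: continuous_on_def)
    moreover have "filterlim exp (at (0::real) within {0..1}) at_bot"
      unfolding filterlim_at
      by (auto simp: exp_at_bot eventually_at_bot_linorder intro!: exI[of _ 0])
    ultimately have "((\<lambda>T. \<gamma> (exp T)) \<longlongrightarrow> \<gamma> 0) at_bot"
      by (rule filterlim_compose)
    then show "((\<lambda>T. \<gamma> (exp T)) \<longlongrightarrow> 0) at_bot"
      by (simp add: \<gamma>_def)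
  qed
  moreover have "E = (\<lambda>_. k)" using k by blast
  ultimately have "k = 0" by (simp add: tendsto_const_iff)
  then have "hankel_arc pi x = (\<lambda>T. of_real (c * \<gamma> (exp T)))"
    using k by (auto simp: E_def)
  moreover have "((\<lambda>T. of_real (c * \<gamma> (exp T)) :: complex) \<longlongrightarrow> of_real (c * Gamma s)) at_top"
  proof (intro tendsto_intros)
    show "((\<lambda>T. \<gamma> (exp T)) \<longlongrightarrow> Gamma s) at_top"
      unfolding \<gamma>_def f_def
      by (rule filterlim_compose[OF lower_incomplete_Gamma_limit[OF s(1)] exp_at_top])
  qed
  moreover have "c * Gamma s = rGamma x"
  proof -
    have "complex_of_real (rGamma x * rGamma s) = rGamma (of_real x) * rGamma (of_real s)"
      by (simp only: rGamma_complex_of_real of_real_mult)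
    also have "\<dots> = sin (of_real pi * of_real x) / of_real pi"
      using rGamma_reflection_complex[of "of_real x"] by (simp add: s_def)
    also have "\<dots> = of_real c"
      by (simp only: c_def of_real_divide of_real_mult flip: sin_of_real)
    finally have "rGamma x * rGamma s = c" by (simp only: of_real_eq_iff)
    moreover have "rGamma s * Gamma s = 1"
      using Gamma_real_pos[OF s(1)] unfolding rGamma_inverse_Gamma by (intro left_inverse) linarith
    ultimately show ?thesis by (metis mult.assoc mult.right_neutral)
  qed
  ultimately show ?thesis by simp
qed

lemma hankel_arc_pi_limit:
  assumes "0 < x"
  shows "((\<lambda>T. hankel_arc pi x T) \<longlongrightarrow> of_real (rGamma x)) at_top"
proof -
  have "\<forall>x>0. x \<le> real n + 1 \<longrightarrow> ((\<lambda>T. hankel_arc pi x T) \<longlongrightarrow> of_real (rGamma x)) at_top" for n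
  proof (induction n)
    case 0
    then show ?case using hankel_arc_pi_limit_le_1 by simp
  next
    case (Suc n)
    show ?case
    proof (intro allI impI)
      fix x :: real assume x: "0 < x" "x \<le> real (Suc n) + 1"
      show "((\<lambda>T. hankel_arc pi x T) \<longlongrightarrow> of_real (rGamma x)) at_top"
      proof (cases "x \<le> 1")
        case False
        define y where "y = x - 1"
        have y: "0 < y" "y \<le> real n + 1" "x = y + 1" using False x by (auto simp: y_def)
        have "((\<lambda>T. (hankel_arc pi y T - (hankel_arc pi y T - of_real y * hankel_arc pi (y + 1) T)) / of_real y)
            \<longlongrightarrow> (of_real (rGamma y) - 0) / of_real y) at_top"
          using y Suc by (intro tendsto_intros hankel_arc_recurrence) auto
        moreover have "rGamma y / y = rGamma x"
          using y rGamma_plus1[of y] by (simp add: field_simps)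
        ultimately show ?thesis using y by (simp flip: of_real_divide)
      qed (use x hankel_arc_pi_limit_le_1 in auto)
    qed
  qed
  moreover obtain n where "x \<le> real n" using real_arch_simple by blast
  then have "x \<le> real n + 1" by simp
  ultimately show ?thesis using assms by blast
qed

lemma hankel_arc_limit:
  assumes "pi / 2 < \<theta>" "\<theta> \<le> pi" "0 < x"
  shows "((\<lambda>T. hankel_arc \<theta> x T) \<longlongrightarrow> of_real (rGamma x)) at_top"
  using tendsto_add[OF hankel_arc_transfer[OF assms(1,2), of x] hankel_arc_pi_limit[OF assms(3)]] by simp

section \<open>The multinomial theorem over compositions\<close>

lemma sum_compositions_Suc:
  "(\<Sum>\<kappa>\<in>compositions (Suc m) k. h \<kappa>) =
   (\<Sum>i\<le>k. \<Sum>\<kappa>\<in>compositions m (k - i). h (\<kappa>(Suc m := i)))"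
proof -
  have sum_upd: "(\<Sum>j=1..m. (\<kappa>(Suc m := i)) j) = (\<Sum>j=1..m. \<kappa> j)" for \<kappa> :: "nat \<Rightarrow> nat" and i
    by (rule sum.cong) auto
  have "(\<Sum>i\<le>k. \<Sum>\<kappa>\<in>compositions m (k - i). h (\<kappa>(Suc m := i))) =
    (\<Sum>(i, \<kappa>)\<in>Sigma {..k} (\<lambda>i. compositions m (k - i)). h (\<kappa>(Suc m := i)))"
    by (rule sum.Sigma) (auto simp: finite_compositions)
  also have "\<dots> = (\<Sum>\<kappa>\<in>compositions (Suc m) k. h \<kappa>)"
  proof (rule sum.reindex_bij_witness[where
        i = "\<lambda>\<kappa>. (\<kappa> (Suc m), \<kappa>(Suc m := undefined))" and j = "\<lambda>(i, \<kappa>). \<kappa>(Suc m := i)"])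
    fix a assume "a \<in> Sigma {..k} (\<lambda>i. compositions m (k - i))"
    then obtain i \<kappa> where a: "a = (i, \<kappa>)" "i \<le> k" "\<kappa> \<in> compositions m (k - i)" by auto
    have "\<kappa> (Suc m) = undefined"
      using a(3) by (auto simp: compositions_def PiE_def extensional_def)
    then show "((case a of (i, \<kappa>) \<Rightarrow> \<kappa>(Suc m := i)) (Suc m),
        (case a of (i, \<kappa>) \<Rightarrow> \<kappa>(Suc m := i))(Suc m := undefined)) = a"
      by (simp add: a(1) fun_upd_idem)
    show "(case a of (i, \<kappa>) \<Rightarrow> \<kappa>(Suc m := i)) \<in> compositions (Suc m) k"
      using a by (auto simp: compositions_def PiE_def extensional_def sum_upd)
    show "h (case a of (i, \<kappa>) \<Rightarrow> \<kappa>(Suc m := i)) = (case a of (i, \<kappa>) \<Rightarrow> h (\<kappa>(Suc m := i)))"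
      by (simp add: a(1))
  next
    fix \<kappa> assume k: "\<kappa> \<in> compositions (Suc m) k"
    show "(case (\<kappa> (Suc m), \<kappa>(Suc m := undefined)) of (i, \<kappa>) \<Rightarrow> \<kappa>(Suc m := i)) = \<kappa>"
      by simp
    show "(\<kappa> (Suc m), \<kappa>(Suc m := undefined)) \<in> Sigma {..k} (\<lambda>i. compositions m (k - i))"
      using k by (auto simp: compositions_def PiE_def extensional_def sum_upd)
  qed
  finally show ?thesis ..
qed

lemma multinomial_theorem:
  fixes w :: "nat \<Rightarrow> complex"
  shows "(\<Sum>\<kappa>\<in>compositions m k. multinomial_coeff m k \<kappa> * (\<Prod>j=1..m. w j ^ \<kappa> j)) = (\<Sum>j=1..m. w j) ^ k"
proof (induction m arbitrary: k)
  case 0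
  have "compositions 0 k = (if k = 0 then {\<lambda>_. undefined} else {})"
    by (auto simp: compositions_def)
  then show ?case by (simp add: multinomial_coeff_def)
next
  case (Suc m)
  have term_Suc: "multinomial_coeff (Suc m) k (\<kappa>(Suc m := i)) * (\<Prod>j=1..Suc m. w j ^ (\<kappa>(Suc m := i)) j)
      = of_nat (k choose i) * w (Suc m) ^ i * (multinomial_coeff m (k - i) \<kappa> * (\<Prod>j=1..m. w j ^ \<kappa> j))"
    if "i \<le> k" for i \<kappa>
  proof -
    have "(\<Prod>j=1..m. fact ((\<kappa>(Suc m := i)) j)) = (\<Prod>j=1..m. fact (\<kappa> j) :: complex)"
      and "(\<Prod>j=1..m. w j ^ (\<kappa>(Suc m := i)) j) = (\<Prod>j=1..m. w j ^ \<kappa> j)"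
      by (auto intro!: prod.cong)
    moreover have "fact k = of_nat (k choose i) * fact i * (fact (k - i) :: complex)"
      using binomial_fact[OF that, where ?'a = complex] by (simp add: field_simps)
    ultimately show ?thesis
      by (simp add: multinomial_coeff_def field_simps)
  qed
  have "(\<Sum>\<kappa>\<in>compositions (Suc m) k. multinomial_coeff (Suc m) k \<kappa> * (\<Prod>j=1..Suc m. w j ^ \<kappa> j))
      = (\<Sum>i\<le>k. \<Sum>\<kappa>\<in>compositions m (k - i).
          of_nat (k choose i) * w (Suc m) ^ i * (multinomial_coeff m (k - i) \<kappa> * (\<Prod>j=1..m. w j ^ \<kappa> j)))"
    unfolding sum_compositions_Suc by (intro sum.cong refl term_Suc) auto
  also have "\<dots> = (\<Sum>i\<le>k. of_nat (k choose i) * w (Suc m) ^ i * (\<Sum>j=1..m. w j) ^ (k - i))"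
    by (simp only: Suc.IH flip: sum_distrib_left)
  also have "\<dots> = (w (Suc m) + (\<Sum>j=1..m. w j)) ^ k"
    by (simp add: binomial_ring)
  finally show ?case by (simp add: add.commute)
qed

text \<open>The multinomial coefficients are positive, so replacing every \<open>w j\<close> by its norm makes the multinomial
theorem an identity for the sum of the norms.\<close>

lemma multinomial_theorem_norm:
  fixes w :: "nat \<Rightarrow> complex"
  shows "(\<Sum>\<kappa>\<in>compositions m k. norm (multinomial_coeff m k \<kappa> * (\<Prod>j=1..m. w j ^ \<kappa> j)))
    = (\<Sum>j=1..m. norm (w j)) ^ k"
proof -
  have "norm (multinomial_coeff m k \<kappa> * (\<Prod>j=1..m. w j ^ \<kappa> j)) =
      Re (multinomial_coeff m k \<kappa> * (\<Prod>j=1..m. of_real (norm (w j)) ^ \<kappa> j))" for \<kappa>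
  proof -
    have "multinomial_coeff m k \<kappa> = of_real (fact k / (\<Prod>j=1..m. fact (\<kappa> j)))"
      by (simp add: multinomial_coeff_def)
    moreover have "(\<Prod>j=1..m. of_real (norm (w j)) ^ \<kappa> j) = complex_of_real (\<Prod>j=1..m. norm (w j) ^ \<kappa> j)"
      by simp
    ultimately have "Re (multinomial_coeff m k \<kappa> * (\<Prod>j=1..m. of_real (norm (w j)) ^ \<kappa> j))
       = fact k / (\<Prod>j=1..m. fact (\<kappa> j)) * (\<Prod>j=1..m. norm (w j) ^ \<kappa> j)"
      by (simp only: Re_complex_of_real flip: of_real_mult)
    moreover have "norm (multinomial_coeff m k \<kappa>) = fact k / (\<Prod>j=1..m. fact (\<kappa> j))"
      by (simp add: multinomial_coeff_def norm_divide flip: prod_norm)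
    ultimately show ?thesis
      by (simp add: norm_mult norm_power flip: prod_norm)
  qed
  then have "(\<Sum>\<kappa>\<in>compositions m k. norm (multinomial_coeff m k \<kappa> * (\<Prod>j=1..m. w j ^ \<kappa> j))) =
     Re (\<Sum>\<kappa>\<in>compositions m k. multinomial_coeff m k \<kappa> * (\<Prod>j=1..m. of_real (norm (w j)) ^ \<kappa> j))"
    by (simp only: Re_sum)
  also have "\<dots> = Re (of_real ((\<Sum>j=1..m. norm (w j)) ^ k))"
    unfolding multinomial_theorem by simp
  finally show ?thesis by simp
qed

section \<open>A linear functional separating two cones\<close>

lemma cos_ge_sin_of_abs_le:
  assumes "0 \<le> \<delta>" "\<bar>x\<bar> \<le> pi / 2 - \<delta>"
  shows "sin \<delta> \<le> cos x"
proof -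
  have "cos (pi / 2 - \<delta>) \<le> cos \<bar>x\<bar>"
    using assms pi_gt_zero by (intro cos_monotone_0_pi_le) (auto simp del: pi_gt_zero)
  then show ?thesis by (simp add: cos_diff)
qed

lemma cos_le_minus_sin:
  assumes "0 \<le> \<delta>" "\<bar>x - pi\<bar> \<le> pi / 2 - \<delta>"
  shows "cos x \<le> - sin \<delta>"
  using cos_ge_sin_of_abs_le[OF assms] by (simp add: cos_diff)

text \<open>The directions \<open>\<psi> j\<close> lie in a sector of opening at most \<open>pi - 2 * \<delta>\<close>, and the direction \<open>\<sigma>\<close> keeps
an angle of at least \<open>2 * \<delta>\<close> from both its sides. Some real linear functional
\<open>w \<mapsto> Re (w * cis (- \<eta>))\<close> is then at least \<open>sin \<delta>\<close> on the unit vectors of the sector and at most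
\<open>- sin \<delta>\<close> in direction \<open>\<sigma>\<close>, so nothing cancels in the difference.\<close>

lemma separated_cones_lower_bound:
  fixes r \<psi> :: "'i \<Rightarrow> real"
  assumes "finite J" "i \<in> J" and r: "\<And>j. j \<in> J \<Longrightarrow> 0 \<le> r j"
    and \<psi>: "\<And>j. j \<in> J \<Longrightarrow> 0 \<le> \<psi> j \<and> \<psi> j \<le> A"
    and "0 \<le> \<rho>" "0 \<le> \<delta>" "A + 2 * \<delta> \<le> \<sigma>" "\<sigma> \<le> 2 * pi - 2 * \<delta>" "A + 2 * \<delta> \<le> pi"
  shows "sin \<delta> * (r i + \<rho>) \<le> norm ((\<Sum>j\<in>J. of_real (r j) * cis (\<psi> j)) - of_real \<rho> * cis \<sigma>)"
proof -
  \<comment> \<open>The admissible angles form two overlapping intervals, one given by the sector and one by \<open>\<sigma>\<close>; this is the smallest angle in both.\<close>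
  define \<eta> where "\<eta> = max (A - pi / 2 + \<delta>) (\<sigma> - 3 * pi / 2 + \<delta>)"
  have "A \<ge> 0" using \<psi>[OF \<open>i \<in> J\<close>] by linarith
  then have \<eta>: "A - pi / 2 + \<delta> \<le> \<eta>" "\<eta> \<le> pi / 2 - \<delta>" "\<bar>\<sigma> - \<eta> - pi\<bar> \<le> pi / 2 - \<delta>"
    using assms by (auto simp: \<eta>_def max_def abs_le_iff)
  have cos_psi: "sin \<delta> \<le> cos (\<psi> j - \<eta>)" if "j \<in> J" for j
    using \<psi>[OF that] \<eta> \<open>0 \<le> \<delta>\<close> by (intro cos_ge_sin_of_abs_le) auto
  have cos_sigma: "cos (\<sigma> - \<eta>) \<le> - sin \<delta>"
    using \<eta> \<open>0 \<le> \<delta>\<close> by (intro cos_le_minus_sin) auto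
  have "sin \<delta> \<ge> 0" using \<open>A \<ge> 0\<close> assms by (intro sin_ge_zero) auto
  have "sin \<delta> * r i \<le> sin \<delta> * (\<Sum>j\<in>J. r j)"
    using assms \<open>sin \<delta> \<ge> 0\<close> by (intro mult_left_mono member_le_sum) auto
  also have "\<dots> \<le> (\<Sum>j\<in>J. r j * cos (\<psi> j - \<eta>))"
    unfolding sum_distrib_left using r cos_psi
    by (intro sum_mono) (auto simp: mult.commute[of "sin \<delta>"] intro: mult_left_mono)
  finally have "sin \<delta> * (r i + \<rho>) \<le> (\<Sum>j\<in>J. r j * cos (\<psi> j - \<eta>)) - \<rho> * cos (\<sigma> - \<eta>)"
    using mult_left_mono[OF cos_sigma \<open>0 \<le> \<rho>\<close>] by (simp add: algebra_simps)
  also have "\<dots> = Re (((\<Sum>j\<in>J. of_real (r j) * cis (\<psi> j)) - of_real \<rho> * cis \<sigma>) * cis (- \<eta>))"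
    by (simp add: left_diff_distrib sum_distrib_right mult.assoc cis_mult Re_sum)
  also have "\<dots> \<le> norm (((\<Sum>j\<in>J. of_real (r j) * cis (\<psi> j)) - of_real \<rho> * cis \<sigma>) * cis (- \<eta>))"
    by (rule complex_Re_le_cmod)
  also have "\<dots> = norm ((\<Sum>j\<in>J. of_real (r j) * cis (\<psi> j)) - of_real \<rho> * cis \<sigma>)"
    by (simp add: norm_mult)
  finally show ?thesis .
qed

section \<open>Integral representation of the multinomial Mittag-Leffler function\<close>

text \<open>The multinomial series sums \<open>hankel \<beta>\<close> times a geometric series with this ratio, so
\<open>1 - ml_symbol m \<alpha> z u\<close> is the denominator of the integral representation.\<close>

definition ml_symbol :: "nat \<Rightarrow> (nat \<Rightarrow> real) \<Rightarrow> (nat \<Rightarrow> complex) \<Rightarrow> complex \<Rightarrow> complex" where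
  "ml_symbol m \<alpha> z u = (\<Sum>j=1..m. z j * exp (- of_real (\<alpha> j) * u))"

lemma hankel_shift:
  fixes \<alpha> :: "nat \<Rightarrow> real"
  shows "hankel (\<beta> + (\<Sum>j=1..m. \<alpha> j * real (\<kappa> j))) u
    = hankel \<beta> u * (\<Prod>j=1..m. exp (- of_real (\<alpha> j) * u) ^ \<kappa> j)"
proof -
  have "(\<Prod>j=1..m. exp (- of_real (\<alpha> j) * u) ^ \<kappa> j)
      = exp (\<Sum>j=1..m. of_nat (\<kappa> j) * (- of_real (\<alpha> j) * u))"
    by (simp only: exp_sum finite_atLeastAtMost exp_of_nat_mult)
  also have "(\<Sum>j=1..m. of_nat (\<kappa> j) * (- of_real (\<alpha> j) * u))
      = - of_real (\<Sum>j=1..m. \<alpha> j * real (\<kappa> j)) * u"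
    by (simp add: sum_distrib_right mult_ac sum_negf sum_distrib_left)
  finally show ?thesis
    by (simp add: hankel_def algebra_simps flip: exp_add)
qed

lemma sum_hankel_compositions:
  "(\<Sum>\<kappa>\<in>compositions m k. multinomial_coeff m k \<kappa> * (\<Prod>j=1..m. z j ^ \<kappa> j) *
      hankel (\<beta> + (\<Sum>j=1..m. \<alpha> j * real (\<kappa> j))) u) = hankel \<beta> u * ml_symbol m \<alpha> z u ^ k"
proof -
  have "multinomial_coeff m k \<kappa> * (\<Prod>j=1..m. z j ^ \<kappa> j) * hankel (\<beta> + (\<Sum>j=1..m. \<alpha> j * real (\<kappa> j))) u
     = hankel \<beta> u * (multinomial_coeff m k \<kappa> * (\<Prod>j=1..m. (z j * exp (- of_real (\<alpha> j) * u)) ^ \<kappa> j))" for \<kappa>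
    unfolding hankel_shift by (simp only: power_mult_distrib prod.distrib mult_ac)
  then show ?thesis
    by (simp only: multinomial_theorem ml_symbol_def flip: sum_distrib_left)
qed

text \<open>Multiplied by \<open>exp (\<alpha> 1 * u)\<close>, the denominator is a sum of terms with phases between \<open>0\<close> and
\<open>\<alpha> 1 * Im u\<close>, minus \<open>z 1\<close>: the exponents \<open>\<alpha> 1 - \<alpha> j\<close> lie between \<open>0\<close> and \<open>\<alpha> 1\<close>, and the
signs of the \<open>z j\<close> make the coefficients nonnegative. These phases stay inside the
sector of half opening \<open>\<mu>\<close> that \<open>z 1\<close> avoids, so the cone separation applies.\<close>

lemma ml_symbol_lower_bound:
  fixes \<alpha> :: "nat \<Rightarrow> real"
  assumes "1 \<le> m" and \<alpha>: "\<And>j. j \<in> {1..m} \<Longrightarrow> 0 \<le> \<alpha> j \<and> \<alpha> j \<le> \<alpha> 1"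
    and z: "\<And>j. j \<in> {2..m} \<Longrightarrow> z j \<in> \<real> \<and> Re (z j) \<le> 0"
    and \<mu>: "\<mu> \<le> \<bar>Arg (z 1)\<bar>" "\<mu> \<le> pi" "\<alpha> 1 * b + 2 * \<delta> \<le> \<mu>" and "0 \<le> \<delta>" and u: "\<bar>Im u\<bar> \<le> b"
  shows "sin \<delta> * (exp (\<alpha> 1 * Re u) + norm (z 1)) \<le> exp (\<alpha> 1 * Re u) * norm (1 - ml_symbol m \<alpha> z u)"
proof -
  define q where "q j = (if j = 1 then \<alpha> 1 else \<alpha> 1 - \<alpha> j)" for j
  define r where "r j = (if j = 1 then 1 else - Re (z j)) * exp (q j * Re u)" for j
  have q: "0 \<le> q j" "q j \<le> \<alpha> 1" if "j \<in> {1..m}" for j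
    using \<alpha>[OF that] \<open>1 \<le> m\<close> by (auto simp: q_def)
  have r: "0 \<le> r j" if "j \<in> {1..m}" for j
    using z[of j] that by (cases "j = 1") (auto simp: r_def mult_nonpos_nonneg)
  have bound: "sin \<delta> * (exp (\<alpha> 1 * Re u) + norm (z 1))
      \<le> norm ((\<Sum>j=1..m. of_real (r j) * cis (q j * p)) - of_real (norm (z 1)) * cis \<sigma>)"
    if "0 \<le> p" "p \<le> b" "\<mu> \<le> \<sigma>" "\<sigma> \<le> 2 * pi - \<mu>" for p \<sigma>
  proof -
    have "sin \<delta> * (r 1 + norm (z 1))
        \<le> norm ((\<Sum>j=1..m. of_real (r j) * cis (q j * p)) - of_real (norm (z 1)) * cis \<sigma>)"
    proof (rule separated_cones_lower_bound)
      show "0 \<le> q j * p \<and> q j * p \<le> \<alpha> 1 * b" if "j \<in> {1..m}" for j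
        using q[OF that] \<open>0 \<le> p\<close> \<open>p \<le> b\<close> by (auto intro: mult_mono)
      have "0 \<le> \<alpha> 1 * b"
        using \<alpha>[of 1] \<open>1 \<le> m\<close> u by simp
      with that \<mu> show "\<sigma> \<le> 2 * pi - 2 * \<delta>" by linarith
    qed (use assms that r in auto)
    then show ?thesis by (simp add: r_def q_def)
  qed
  \<comment> \<open>The sector and \<open>\<sigma>\<close> are compared as real angles, so the argument is taken in \<open>[0, 2 * pi)\<close>.\<close>
  define \<sigma> where "\<sigma> = (if 0 \<le> Arg (z 1) then Arg (z 1) else Arg (z 1) + 2 * pi)"
  have \<sigma>: "\<mu> \<le> \<sigma>" "\<sigma> \<le> 2 * pi - \<mu>"
    using \<mu> Arg_bounded[of "z 1"] by (auto simp: \<sigma>_def)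
  have "cis \<sigma> = cis (Arg (z 1))"
    by (simp add: \<sigma>_def complex_eq_iff)
  then have z1: "z 1 = of_real (norm (z 1)) * cis \<sigma>"
    using rcis_cmod_Arg[of "z 1"] by (simp add: rcis_def)
  have "exp (of_real (\<alpha> 1) * u) * (1 - ml_symbol m \<alpha> z u)
      = (\<Sum>j=1..m. of_real (r j) * cis (q j * Im u)) - z 1"
  proof -
    have exp_q: "exp (of_real (q j) * u) = of_real (exp (q j * Re u)) * cis (q j * Im u)" for j
      by (subst exp_eq_polar) simp
    have split: "(\<Sum>j=1..m. h j) = h 1 + (\<Sum>j=2..m. h j)" for h :: "nat \<Rightarrow> complex"
      using \<open>1 \<le> m\<close> by (simp add: sum.atLeast_Suc_atMost numeral_2_eq_2)
    have other: "exp (of_real (\<alpha> 1) * u) * (z j * exp (- of_real (\<alpha> j) * u)) = - (of_real (r j) * cis (q j * Im u))"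
      if "j \<in> {2..m}" for j
    proof -
      have "z j = of_real (Re (z j))" using z[OF that] by (simp add: complex_is_Real_iff complex_eq_iff)
      moreover have "exp (of_real (\<alpha> 1) * u) * exp (- of_real (\<alpha> j) * u) = exp (of_real (q j) * u)"
        using that by (simp add: q_def algebra_simps flip: exp_add)
      ultimately show ?thesis
        using that unfolding exp_q by (simp add: r_def)
    qed
    have first: "exp (of_real (\<alpha> 1) * u) = of_real (r 1) * cis (q 1 * Im u)"
      using exp_q[of 1] by (simp add: r_def q_def)
    have cancel: "exp (of_real (\<alpha> 1) * u) * (z 1 * exp (- of_real (\<alpha> 1) * u)) = z 1"
      by (simp add: exp_minus)
    have "exp (of_real (\<alpha> 1) * u) * (1 - ml_symbol m \<alpha> z u)
        = exp (of_real (\<alpha> 1) * u) - (exp (of_real (\<alpha> 1) * u) * (z 1 * exp (- of_real (\<alpha> 1) * u))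
          + (\<Sum>j=2..m. exp (of_real (\<alpha> 1) * u) * (z j * exp (- of_real (\<alpha> j) * u))))"
      unfolding ml_symbol_def split by (simp only: right_diff_distrib distrib_left sum_distrib_left mult_1_right)
    also have "(\<Sum>j=2..m. exp (of_real (\<alpha> 1) * u) * (z j * exp (- of_real (\<alpha> j) * u)))
        = (\<Sum>j=2..m. - (of_real (r j) * cis (q j * Im u)))"
      by (rule sum.cong[OF refl other])
    finally show ?thesis
      unfolding cancel split first[symmetric] by (simp add: sum_negf)
  qed
  then have "exp (\<alpha> 1 * Re u) * norm (1 - ml_symbol m \<alpha> z u)
      = norm ((\<Sum>j=1..m. of_real (r j) * cis (q j * Im u)) - z 1)"
    by (metis (no_types, lifting) Re_complex_of_real Re_exp norm_mult norm_exp_eq_Re times_complex.simps(1)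
        Im_complex_of_real diff_zero mult_zero_left)
  also have "sin \<delta> * (exp (\<alpha> 1 * Re u) + norm (z 1)) \<le> \<dots>"
  proof (cases "0 \<le> Im u")
    case True
    then show ?thesis using bound[of "Im u" \<sigma>] \<sigma> u z1 by simp
  next
    case False
    \<comment> \<open>Below the real axis the phases are negative; conjugation reduces to the case above.\<close>
    have "cis (2 * pi - \<sigma>) = cnj (cis \<sigma>)"
      by (simp add: complex_eq_iff cos_diff sin_diff)
    then have "(\<Sum>j=1..m. of_real (r j) * cis (q j * - Im u)) - of_real (norm (z 1)) * cis (2 * pi - \<sigma>)
       = cnj ((\<Sum>j=1..m. of_real (r j) * cis (q j * Im u)) - of_real (norm (z 1)) * cis \<sigma>)"
      by (simp add: cis_cnj)
    then show ?thesis
      using bound[of "- Im u" "2 * pi - \<sigma>"] \<sigma> u z1 False by (simp only: complex_mod_cnj)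
  qed
  finally show ?thesis .
qed

lemma ml_symbol_small:
  assumes \<alpha>: "\<And>j. j \<in> {1..m} \<Longrightarrow> 0 < \<alpha> j"
  obtains T0 where "\<And>T. T0 \<le> T \<Longrightarrow> (\<Sum>j=1..m. norm (z j :: complex) * exp (- \<alpha> j * T)) \<le> 1 / 2"
proof -
  have "((\<lambda>T. \<Sum>j=1..m. norm (z j) * exp (- \<alpha> j * T)) \<longlongrightarrow> (\<Sum>j=1..m. norm (z j) * 0)) at_top"
  proof (intro tendsto_intros)
    fix j assume "j \<in> {1..m}"
    then have "0 < \<alpha> j" by (rule \<alpha>)
    then show "((\<lambda>T. exp (- \<alpha> j * T)) \<longlongrightarrow> 0) at_top" by real_asymp
  qed
  then have "eventually (\<lambda>T. (\<Sum>j=1..m. norm (z j) * exp (- \<alpha> j * T)) < 1 / 2) at_top"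
    by (intro order_tendstoD(2)[where y = 0]) auto
  then obtain T0 where "\<And>T. T0 \<le> T \<Longrightarrow> (\<Sum>j=1..m. norm (z j) * exp (- \<alpha> j * T)) < 1 / 2"
    unfolding eventually_at_top_linorder by blast
  then show ?thesis using that less_imp_le by metis
qed

text \<open>The representation
\<open>E(z) = 1 / (2 \<pi> \<i>) * \<integral> exp s * s powr (- \<beta>) / (1 - \<Sum>\<^sub>j z j * s powr (- \<alpha> j)) ds\<close> over
Hankel's contour, in logarithmic form. For fixed large \<open>T\<close> the geometric series converges uniformly
on the chord and may be integrated termwise. By Hankel's formula the terms converge to those of the
Mittag-Leffler series as \<open>T\<close> grows, and Tannery's theorem permits taking the limit termwise. The
equation is a limit, so it survives moving the contour into the region where the
geometric series diverges.\<close>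

lemma multinomial_ML_limit_chord_increment:
  fixes \<alpha> :: "nat \<Rightarrow> real"
  assumes \<alpha>: "\<And>j. j \<in> {1..m} \<Longrightarrow> 0 < \<alpha> j" and "0 < \<beta>" and \<theta>: "pi / 2 < \<theta>" "\<theta> \<le> pi"
    and G: "\<And>u. \<bar>Im u\<bar> \<le> \<theta> \<Longrightarrow>
      (G has_field_derivative hankel \<beta> u / (1 - ml_symbol m \<alpha> z u)) (at u)"
  shows "((\<lambda>T. chord_increment G \<theta> T / (2 * of_real pi * \<i>)) \<longlongrightarrow> multinomial_ML m \<alpha> \<beta> z) at_top"
proof -
  define x where "x \<kappa> = \<beta> + (\<Sum>j=1..m. \<alpha> j * real (\<kappa> j))" for \<kappa>
  define q where "q k \<kappa> = multinomial_coeff m k \<kappa> * (\<Prod>j=1..m. z j ^ \<kappa> j)" for k \<kappa>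
  define a where "a k T = (\<Sum>\<kappa>\<in>compositions m k. q k \<kappa> * hankel_arc \<theta> (x \<kappa>) T)" for k T
  have x: "0 < x \<kappa>" for \<kappa>
    unfolding x_def using \<open>0 < \<beta>\<close> \<alpha> by (intro add_pos_nonneg sum_nonneg) (auto simp: less_imp_le)
  \<comment> \<open>To the right of \<open>T0\<close> the ratio of the geometric series is at most one half.\<close>
  obtain T0 where T0: "\<And>T. T0 \<le> T \<Longrightarrow> (\<Sum>j=1..m. norm (z j) * exp (- \<alpha> j * T)) \<le> 1 / 2"
    using ml_symbol_small[OF \<alpha>, of m "\<lambda>j. j" z] by blast
  obtain C where C: "C > 0" "\<And>x T. 0 \<le> x \<Longrightarrow> T0 \<le> T \<Longrightarrow> norm (hankel_arc \<theta> x T) \<le> C * exp (- x * T0)"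
    using hankel_arc_bound[OF \<theta>] by blast
  have norm_w: "norm (z j * exp (- of_real (\<alpha> j) * u)) = norm (z j) * exp (- \<alpha> j * Re u)" for j u
    by (simp add: norm_mult)
  have small: "norm (ml_symbol m \<alpha> z u) \<le> 1 / 2" if "T0 \<le> Re u" for u
    unfolding ml_symbol_def using T0[OF that] by (intro order_trans[OF norm_sum]) (simp only: norm_w)
  have a_bound: "norm (a k T) \<le> C * exp (- \<beta> * T0) * (1 / 2) ^ k" if "T0 \<le> T" for k T
  proof -
    let ?w = "\<lambda>j. z j * exp (- of_real (\<alpha> j) * of_real T0)"
    have "norm (q k \<kappa> * hankel_arc \<theta> (x \<kappa>) T)
        \<le> C * exp (- \<beta> * T0) * norm (multinomial_coeff m k \<kappa> * (\<Prod>j=1..m. ?w j ^ \<kappa> j))" for \<kappa>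
    proof -
      have "norm (q k \<kappa> * hankel_arc \<theta> (x \<kappa>) T) \<le> norm (q k \<kappa>) * (C * exp (- x \<kappa> * T0))"
        unfolding norm_mult using C(2)[of "x \<kappa>" T] x[of \<kappa>] that by (intro mult_left_mono) auto
      also have "exp (- x \<kappa> * T0) = exp (- \<beta> * T0) * (\<Prod>j=1..m. exp (- \<alpha> j * T0) ^ \<kappa> j)"
      proof -
        have "(\<Prod>j=1..m. exp (- \<alpha> j * T0) ^ \<kappa> j) = exp (\<Sum>j=1..m. real (\<kappa> j) * (- \<alpha> j * T0))"
          by (simp only: exp_sum finite_atLeastAtMost exp_of_nat_mult)
        also have "(\<Sum>j=1..m. real (\<kappa> j) * (- \<alpha> j * T0)) = - (\<Sum>j=1..m. \<alpha> j * real (\<kappa> j)) * T0"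
          by (simp add: sum_distrib_right mult_ac sum_negf sum_distrib_left)
        finally show ?thesis by (simp add: x_def algebra_simps flip: exp_add)
      qed
      also have "norm (q k \<kappa>) * (C * (exp (- \<beta> * T0) * (\<Prod>j=1..m. exp (- \<alpha> j * T0) ^ \<kappa> j)))
          = C * exp (- \<beta> * T0) * norm (multinomial_coeff m k \<kappa> * (\<Prod>j=1..m. ?w j ^ \<kappa> j))"
        by (simp add: q_def norm_mult norm_power power_mult_distrib prod.distrib flip: prod_norm)
      finally show ?thesis .
    qed
    then have "norm (a k T) \<le> (\<Sum>\<kappa>\<in>compositions m k.
        C * exp (- \<beta> * T0) * norm (multinomial_coeff m k \<kappa> * (\<Prod>j=1..m. ?w j ^ \<kappa> j)))"
      unfolding a_def by (intro sum_norm_le) auto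
    also have "\<dots> = C * exp (- \<beta> * T0) * (\<Sum>j=1..m. norm (?w j)) ^ k"
      by (simp only: multinomial_theorem_norm flip: sum_distrib_left)
    also have "\<dots> \<le> C * exp (- \<beta> * T0) * (1 / 2) ^ k"
      using T0[of T0] C(1) unfolding norm_w
      by (intro mult_left_mono power_mono sum_nonneg) auto
    finally show ?thesis .
  qed
  have sums: "(\<lambda>k. a k T) sums (chord_increment G \<theta> T / (2 * of_real pi * \<i>))" if "T0 \<le> T" for T
  proof -
    define V where "V = exp (exp T) * exp ((1 - \<beta>) * T)"
    have "norm ((\<Sum>k<N. a k T) - chord_increment G \<theta> T / (2 * of_real pi * \<i>)) \<le> 4 * \<theta> * V / (2 * pi) * (1 / 2) ^ N" for N
    proof -
      \<comment> \<open>A primitive of the remainder of the geometric series.\<close>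
      define E where "E u = (\<Sum>k<N. \<Sum>\<kappa>\<in>compositions m k. q k \<kappa> * hankel_primitive (x \<kappa>) u) - G u" for u
      have "norm (E (of_real T + \<i> * of_real \<theta>) - E (of_real T + \<i> * of_real (- \<theta>)))
          \<le> 2 * V * (1 / 2) ^ N * (\<theta> - (- \<theta>))"
      proof (rule vertical_increment_bound)
        show "- \<theta> \<le> \<theta>" using \<theta> pi_gt_zero by linarith
        fix y assume y: "- \<theta> \<le> y" "y \<le> \<theta>"
        let ?u = "of_real T + \<i> * of_real y :: complex"
        let ?W = "ml_symbol m \<alpha> z ?u"
        have W: "norm ?W \<le> 1 / 2" using small[of ?u] that by simp
        then have "?W \<noteq> 1" by auto
        have "(E has_field_derivative (\<Sum>k<N. \<Sum>\<kappa>\<in>compositions m k. q k \<kappa> * hankel (x \<kappa>) ?u)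
            - hankel \<beta> ?u / (1 - ?W)) (at ?u)"
          unfolding E_def using y
          by (intro DERIV_diff DERIV_sum DERIV_cmult hankel_primitive G) auto
        also have "(\<Sum>k<N. \<Sum>\<kappa>\<in>compositions m k. q k \<kappa> * hankel (x \<kappa>) ?u) = hankel \<beta> ?u * (\<Sum>k<N. ?W ^ k)"
          by (simp only: q_def x_def sum_hankel_compositions sum_distrib_left)
        also have "\<dots> - hankel \<beta> ?u / (1 - ?W) = - hankel \<beta> ?u * (?W ^ N / (1 - ?W))"
        proof -
          have "hankel \<beta> ?u * ((1 - ?W ^ N) / (1 - ?W)) - hankel \<beta> ?u / (1 - ?W)
              = - hankel \<beta> ?u * (?W ^ N / (1 - ?W))"
            by (simp add: diff_divide_distrib right_diff_distrib)
          then show ?thesis using \<open>?W \<noteq> 1\<close> by (simp add: sum_gp_strict)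
        qed
        finally show "(E has_field_derivative - hankel \<beta> ?u * (?W ^ N / (1 - ?W))) (at ?u)" .
        have "1 / 2 \<le> norm (1 - ?W)"
          using W norm_triangle_ineq2[of 1 ?W] by simp
        then have "norm (?W ^ N / (1 - ?W)) \<le> (1 / 2) ^ N / (1 / 2)"
          unfolding norm_divide norm_power using W by (intro frac_le power_mono) auto
        moreover have "norm (hankel \<beta> ?u) \<le> V"
          by (simp add: norm_hankel V_def)
        ultimately have "norm (hankel \<beta> ?u) * norm (?W ^ N / (1 - ?W)) \<le> V * ((1 / 2) ^ N / (1 / 2))"
          by (intro mult_mono) (auto simp: V_def)
        then show "norm (- hankel \<beta> ?u * (?W ^ N / (1 - ?W))) \<le> 2 * V * (1 / 2) ^ N"
          unfolding norm_mult norm_minus_cancel by simp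
      qed
      moreover have "E (of_real T + \<i> * of_real \<theta>) - E (of_real T + \<i> * of_real (- \<theta>))
          = ((\<Sum>k<N. a k T) - chord_increment G \<theta> T / (2 * of_real pi * \<i>)) * (2 * of_real pi * \<i>)"
      proof -
        have arc: "hankel_arc \<theta> y T * (2 * of_real pi * \<i>) = chord_increment (hankel_primitive y) \<theta> T" for y
          by (simp add: hankel_arc_def)
        have "(\<Sum>k<N. a k T) * (2 * of_real pi * \<i>)
            = (\<Sum>k<N. \<Sum>\<kappa>\<in>compositions m k. q k \<kappa> * chord_increment (hankel_primitive (x \<kappa>)) \<theta> T)"
          unfolding a_def sum_distrib_right by (simp only: mult.assoc[of "q k \<kappa>" for k \<kappa>] arc)
        then show ?thesis
          by (simp add: left_diff_distrib E_def)
            (simp add: chord_increment_def right_diff_distrib sum_subtractf)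
      qed
      moreover have "norm (X * (2 * of_real pi * \<i>)) = norm X * (2 * pi)" for X
        by (simp add: norm_mult)
      ultimately have "norm ((\<Sum>k<N. a k T) - chord_increment G \<theta> T / (2 * of_real pi * \<i>)) * (2 * pi)
          \<le> 4 * \<theta> * V * (1 / 2) ^ N"
        by (simp only:) (simp add: mult_ac)
      then have "norm ((\<Sum>k<N. a k T) - chord_increment G \<theta> T / (2 * of_real pi * \<i>))
          \<le> 4 * \<theta> * V * (1 / 2) ^ N / (2 * pi)"
        by (subst pos_le_divide_eq) auto
      then show ?thesis by (simp only: times_divide_eq_left)
    qed
    moreover have "(\<lambda>N. 4 * \<theta> * V / (2 * pi) * (1 / 2) ^ N) \<longlonglongrightarrow> 0"
      by (intro tendsto_mult_right_zero LIMSEQ_power_zero) auto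
    ultimately have "(\<lambda>N. (\<Sum>k<N. a k T) - chord_increment G \<theta> T / (2 * of_real pi * \<i>)) \<longlonglongrightarrow> 0"
      by (rule Lim_null_comparison[OF always_eventually[OF allI]])
    then show ?thesis by (simp add: sums_def LIM_zero_iff)
  qed
  define b where "b k = (\<Sum>\<kappa>\<in>compositions m k. q k \<kappa> * of_real (rGamma (x \<kappa>)))" for k
  have lim: "((\<lambda>T. \<Sum>k. a k T) \<longlongrightarrow> (\<Sum>k. b k)) at_top"
  proof (rule tannerys_theorem[THEN conjunct2, THEN conjunct2])
    show "((\<lambda>T. a k T) \<longlongrightarrow> b k) at_top" for k
      unfolding a_def b_def using \<theta> x by (intro tendsto_intros hankel_arc_limit)
    show "eventually (\<lambda>(k, T). norm (a k T) \<le> C * exp (- \<beta> * T0) * (1 / 2) ^ k) (at_top \<times>\<^sub>F at_top)"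
      by (rule eventually_mono[OF eventually_prodI[OF always_eventually eventually_ge_at_top[of T0]]])
         (use a_bound in auto)
    show "summable (\<lambda>k. C * exp (- \<beta> * T0) * (1 / 2) ^ k)"
      by (intro summable_mult summable_geometric) auto
  qed auto
  have "(\<Sum>k. b k) = multinomial_ML m \<alpha> \<beta> z"
    by (simp add: multinomial_ML_def b_def q_def x_def rGamma_inverse_Gamma divide_inverse)
  with lim have lim': "((\<lambda>T. \<Sum>k. a k T) \<longlongrightarrow> multinomial_ML m \<alpha> \<beta> z) at_top"
    by simp
  have "eventually (\<lambda>T. (\<Sum>k. a k T) = chord_increment G \<theta> T / (2 * of_real pi * \<i>)) at_top"
    using eventually_ge_at_top[of T0] by eventually_elim (rule sums_unique[OF sums, symmetric])
  then show ?thesis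
    using lim' by (rule Lim_transform_eventually[rotated])
qed

section \<open>The decay estimate\<close>

lemma exp_mult_le_double_exp:
  assumes "(c :: real) > 0"
  obtains P where "P > 0" "\<And>t. 0 \<le> t \<Longrightarrow> exp (a * t) \<le> P * exp (c * exp t)"
proof -
  have "((\<lambda>t. exp (a * t - c * exp t)) \<longlongrightarrow> 0) at_top"
    using assms by real_asymp
  then have "((\<lambda>t. exp (a * t) * exp (- c * exp t)) \<longlongrightarrow> 0) at_top"
    by (simp flip: exp_add)
  then have "eventually (\<lambda>t. exp (a * t) * exp (- c * exp t) < 1) at_top"
    by (intro order_tendstoD(2)) auto
  then obtain t1 where t1: "\<And>t. t1 \<le> t \<Longrightarrow> exp (a * t) * exp (- c * exp t) < 1"
    unfolding eventually_at_top_linorder by blast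
  define P where "P = exp (\<bar>a\<bar> * \<bar>t1\<bar>)"
  have le: "exp (a * t) * exp (- c * exp t) \<le> P" if "0 \<le> t" for t
  proof (cases "t1 \<le> t")
    case True
    have "1 \<le> P" by (simp add: P_def)
    with t1[OF True] show ?thesis by linarith
  next
    case False
    have "a * t \<le> \<bar>a\<bar> * \<bar>t1\<bar>"
      using that False by (intro mult_mono) auto
    moreover have "exp (- c * exp t) \<le> 1" using assms by simp
    ultimately have "exp (a * t) * exp (- c * exp t) \<le> P * 1"
      unfolding P_def by (intro mult_mono) auto
    then show ?thesis by simp
  qed
  have "exp (a * t) \<le> P * exp (c * exp t)" if "0 \<le> t" for t
    using le[OF that] by (simp add: exp_minus field_simps)
  moreover have "P > 0" by (simp add: P_def)
  ultimately show ?thesis using that by blast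
qed

lemma ml_symbol_primitive:
  assumes "\<And>u. \<bar>Im u\<bar> < b \<Longrightarrow> ml_symbol m \<alpha> z u \<noteq> 1"
  obtains G where "\<And>u. \<bar>Im u\<bar> < b \<Longrightarrow>
    (G has_field_derivative hankel \<beta> u / (1 - ml_symbol m \<alpha> z u)) (at u)"
proof -
  define S where "S = {u. Im u < b} \<inter> {u. - b < Im u}"
  have "convex S" "open S"
    unfolding S_def
    by (auto intro!: convex_Int open_Int convex_halfspace_Im_lt convex_halfspace_Im_gt
        open_halfspace_Im_lt open_halfspace_Im_gt)
  moreover have "(\<lambda>u. hankel \<beta> u / (1 - ml_symbol m \<alpha> z u)) holomorphic_on S"
    unfolding hankel_def ml_symbol_def
    by (intro holomorphic_intros) (use assms in \<open>force simp: S_def ml_symbol_def\<close>)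
  ultimately obtain G where G: "\<And>u. u \<in> S \<Longrightarrow>
      (G has_field_derivative hankel \<beta> u / (1 - ml_symbol m \<alpha> z u)) (at u within S)"
    using holomorphic_convex_primitive' by blast
  show ?thesis
  proof
    fix u :: complex assume "\<bar>Im u\<bar> < b"
    then have "u \<in> S" by (auto simp: S_def)
    then show "(G has_field_derivative hankel \<beta> u / (1 - ml_symbol m \<alpha> z u)) (at u)"
      using G \<open>open S\<close> at_within_open by metis
  qed
qed

text \<open>With the contour fixed at \<open>Re u = 0\<close>, the integrand is at most a fixed integrable function divided by
\<open>sin \<delta> * (1 + norm (z 1))\<close>. The angles and the integrable function are chosen before \<open>z\<close>, which
makes the constant uniform.\<close>

theorem lemma3p3:
  fixes m :: nat and \<alpha> :: "nat \<Rightarrow> real" and \<beta> \<mu> K :: real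
  assumes "1 \<le> m"
    and "0 < \<beta>"
    and "\<And>i j. 1 \<le> i \<Longrightarrow> i < j \<Longrightarrow> j \<le> m \<Longrightarrow> \<alpha> j < \<alpha> i"
    and "0 < \<alpha> m"
    and "0 < \<alpha> 1" and "\<alpha> 1 < 2"
    and "\<alpha> 1 * pi / 2 < \<mu>" and "\<mu> < min (\<alpha> 1 * pi) pi"
    and "0 < K"
  shows "\<exists>C>0. \<forall>z :: nat \<Rightarrow> complex.
           \<mu> \<le> \<bar>Arg (z 1)\<bar> \<and> \<bar>Arg (z 1)\<bar> \<le> pi \<and>
           (\<forall>j\<in>{2..m}. z j \<in> \<real> \<and> - K \<le> Re (z j) \<and> Re (z j) < 0) \<longrightarrow>
           norm (multinomial_ML m \<alpha> \<beta> z) \<le> C / (1 + norm (z 1))"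
proof -
  have \<alpha>_le: "\<alpha> j \<le> \<alpha> 1" and \<alpha>_pos: "0 < \<alpha> j" if "j \<in> {1..m}" for j
    using that assms(3)[of 1 j] assms(3)[of j m] assms(4)
    by (cases "j = 1"; cases "j = m"; force)+
  \<comment> \<open>The rays need an angle \<open>\<theta>\<close> above \<open>pi / 2\<close> for decay and below \<open>\<mu> / \<alpha> 1\<close> to keep the phases away from \<open>z 1\<close>; \<open>b > \<theta>\<close> gives an open strip around them.\<close>
  define \<phi> where "\<phi> = \<mu> / \<alpha> 1"
  have \<phi>: "pi / 2 < \<phi>" "\<phi> < pi"
    using assms by (auto simp: \<phi>_def field_simps)
  define \<theta> where "\<theta> = (pi / 2 + \<phi>) / 2"
  define b where "b = (\<theta> + \<phi>) / 2"
  define \<delta> where "\<delta> = (\<mu> - \<alpha> 1 * b) / 2"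
  have \<theta>: "pi / 2 < \<theta>" "\<theta> \<le> pi" and b: "\<theta> < b" "b < \<phi>"
    unfolding b_def \<theta>_def using \<phi> by (simp_all add: field_simps)
  have "0 < b" using \<theta> b pi_gt_zero by linarith
  have \<delta>: "0 < \<delta>" "\<alpha> 1 * b + 2 * \<delta> \<le> \<mu>"
    using b assms by (auto simp: \<delta>_def \<phi>_def field_simps)
  have "\<delta> < pi"
    using \<delta> \<open>0 < b\<close> assms mult_pos_pos[of "\<alpha> 1" b] by linarith
  with \<delta> have s: "0 < sin \<delta>" by (intro sin_gt_zero) auto
  \<comment> \<open>One half of the decay rate on the rays absorbs the factor \<open>exp ((\<alpha> 1 - \<beta>) * t)\<close>.\<close>
  define c where "c = - cos \<theta> / 2"
  have c: "0 < c" using \<theta> cos_lt_zero_pi[of \<theta>] by (simp add: c_def)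
  obtain P where P: "P > 0" "\<And>t. 0 \<le> t \<Longrightarrow> exp ((\<alpha> 1 - \<beta>) * t) \<le> P * exp (c * exp t)"
    using exp_mult_le_double_exp[OF c] by blast
  define C where "C = (2 * \<theta> * exp 1 + 2 * P / c) / (2 * pi * sin \<delta>)"
  have "0 < C"
  proof -
    have "0 < \<theta>" using \<theta> pi_gt_zero by linarith
    then show ?thesis unfolding C_def using P s c by (intro divide_pos_pos add_pos_pos) auto
  qed
  moreover have "norm (multinomial_ML m \<alpha> \<beta> z) \<le> C / (1 + norm (z 1))"
    if z1: "\<mu> \<le> \<bar>Arg (z 1)\<bar>" and z: "\<And>j. j \<in> {2..m} \<Longrightarrow> z j \<in> \<real> \<and> Re (z j) < 0"
    for z :: "nat \<Rightarrow> complex"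
  proof -
    define D where "D = sin \<delta> * (1 + norm (z 1))"
    have D: "0 < D" using s by (simp add: D_def add_pos_nonneg)
    have lower: "sin \<delta> * (exp (\<alpha> 1 * Re u) + norm (z 1))
        \<le> exp (\<alpha> 1 * Re u) * norm (1 - ml_symbol m \<alpha> z u)" if "\<bar>Im u\<bar> \<le> b" for u
    proof (rule ml_symbol_lower_bound[where \<mu> = \<mu> and b = b])
      show "0 \<le> \<alpha> j \<and> \<alpha> j \<le> \<alpha> 1" if "j \<in> {1..m}" for j
        using \<alpha>_le[OF that] \<alpha>_pos[OF that] by simp
      show "z j \<in> \<real> \<and> Re (z j) \<le> 0" if "j \<in> {2..m}" for j
        using z[OF that] by simp
    qed (use that assms z1 \<delta> in auto)
    have "ml_symbol m \<alpha> z u \<noteq> 1" if "\<bar>Im u\<bar> < b" for u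
    proof
      assume "ml_symbol m \<alpha> z u = 1"
      then have "sin \<delta> * (exp (\<alpha> 1 * Re u) + norm (z 1)) \<le> 0"
        using lower[of u] that by simp
      moreover have "0 < sin \<delta> * (exp (\<alpha> 1 * Re u) + norm (z 1))"
        using s by (simp add: add_pos_nonneg)
      ultimately show False by simp
    qed
    then obtain G where G: "\<And>u. \<bar>Im u\<bar> < b \<Longrightarrow>
        (G has_field_derivative hankel \<beta> u / (1 - ml_symbol m \<alpha> z u)) (at u)"
      using ml_symbol_primitive by blast
    have integrand: "norm (hankel \<beta> u / (1 - ml_symbol m \<alpha> z u))
        \<le> exp (exp (Re u) * cos (Im u)) * (exp (Re u) * exp ((\<alpha> 1 - \<beta>) * Re u)) / D"
      if u: "0 \<le> Re u" "\<bar>Im u\<bar> \<le> \<theta>" for u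
    proof -
      have "D \<le> sin \<delta> * (exp (\<alpha> 1 * Re u) + norm (z 1))"
        unfolding D_def using s u assms by (intro mult_left_mono add_right_mono) auto
      also have "\<dots> \<le> exp (\<alpha> 1 * Re u) * norm (1 - ml_symbol m \<alpha> z u)"
        using lower u b by simp
      finally have *: "D \<le> exp (\<alpha> 1 * Re u) * norm (1 - ml_symbol m \<alpha> z u)" .
      then have "norm (1 - ml_symbol m \<alpha> z u) \<noteq> 0" using D by auto
      have "norm (hankel \<beta> u / (1 - ml_symbol m \<alpha> z u))
          = norm (hankel \<beta> u) * exp (\<alpha> 1 * Re u) / (exp (\<alpha> 1 * Re u) * norm (1 - ml_symbol m \<alpha> z u))"
        by (simp add: norm_divide)
      also have "\<dots> \<le> norm (hankel \<beta> u) * exp (\<alpha> 1 * Re u) / D"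
        using * D by (intro divide_left_mono) auto
      also have "norm (hankel \<beta> u) * exp (\<alpha> 1 * Re u)
          = exp (exp (Re u) * cos (Im u)) * (exp (Re u) * exp ((\<alpha> 1 - \<beta>) * Re u))"
        unfolding norm_hankel by (simp add: algebra_simps flip: exp_add)
      finally show ?thesis .
    qed
    have "norm (chord_increment G \<theta> T) \<le> 2 * \<theta> * (exp 1 / D) + 2 * (P / D) / c" if "0 \<le> T" for T
    proof (rule chord_increment_bound[where a = 0 and f = "\<lambda>u. hankel \<beta> u / (1 - ml_symbol m \<alpha> z u)"])
      fix u :: complex assume u: "Re u = 0" "\<bar>Im u\<bar> \<le> \<theta>"
      have "exp (cos (Im u)) / D \<le> exp 1 / D"
        using D by (intro divide_right_mono) auto
      then show "norm (hankel \<beta> u / (1 - ml_symbol m \<alpha> z u)) \<le> exp 1 / D"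
        using integrand[of u] u by simp
    next
      fix u :: complex assume u: "0 \<le> Re u" "\<bar>Im u\<bar> = \<theta>"
      then have cos: "cos (Im u) = - 2 * c" unfolding c_def by (metis cos_abs_real mult_minus_left
            minus_divide_left nonzero_mult_div_cancel_left minus_minus times_divide_eq_right
            zero_neq_numeral)
      have "exp (exp (Re u) * cos (Im u)) * (exp (Re u) * exp ((\<alpha> 1 - \<beta>) * Re u))
          \<le> exp (exp (Re u) * cos (Im u)) * (exp (Re u) * (P * exp (c * exp (Re u))))"
        using P(2)[OF u(1)] by (intro mult_left_mono) auto
      also have "\<dots> = P * (exp (Re u) * (exp (exp (Re u) * cos (Im u)) * exp (c * exp (Re u))))"
        by (simp only: mult_ac)
      also have "exp (exp (Re u) * cos (Im u)) * exp (c * exp (Re u)) = exp (- c * exp (Re u))"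
        unfolding cos by (simp flip: exp_add)
      finally have "exp (exp (Re u) * cos (Im u)) * (exp (Re u) * exp ((\<alpha> 1 - \<beta>) * Re u)) / D
          \<le> P * (exp (Re u) * exp (- c * exp (Re u))) / D"
        using D by (intro divide_right_mono) auto
      then show "norm (hankel \<beta> u / (1 - ml_symbol m \<alpha> z u))
          \<le> P / D * (exp (Re u) * exp (- c * exp (Re u)))"
        using integrand[of u] u by simp
    qed (use that \<theta> b c D P(1) G pi_gt_zero in \<open>auto simp del: pi_gt_zero\<close>)
    also have "2 * \<theta> * (exp 1 / D) + 2 * (P / D) / c = C / (1 + norm (z 1)) * (2 * pi)"
    proof -
      have "X / (2 * pi * sin \<delta>) / (1 + norm (z 1)) * (2 * pi) = X / D" for X
      proof -
        have "X / (2 * pi * sin \<delta>) / (1 + norm (z 1)) = X / D / (2 * pi)"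
          unfolding D_def by (simp only: divide_divide_eq_left mult_ac)
        then show ?thesis by simp
      qed
      then have "C / (1 + norm (z 1)) * (2 * pi) = (2 * \<theta> * exp 1 + 2 * P / c) / D"
        unfolding C_def .
      also have "\<dots> = 2 * \<theta> * (exp 1 / D) + 2 * (P / D) / c"
        by (simp add: add_divide_distrib mult_ac)
      finally show ?thesis ..
    qed
    finally have "norm (chord_increment G \<theta> T / (2 * of_real pi * \<i>)) \<le> C / (1 + norm (z 1))" if "0 \<le> T" for T
      using that by (simp add: norm_divide norm_mult field_simps)
    then have "eventually (\<lambda>T. norm (chord_increment G \<theta> T / (2 * of_real pi * \<i>)) \<le> C / (1 + norm (z 1))) at_top"
      by (rule eventually_mono[OF eventually_ge_at_top[of 0]])
    moreover have "((\<lambda>T. chord_increment G \<theta> T / (2 * of_real pi * \<i>)) \<longlongrightarrow> multinomial_ML m \<alpha> \<beta> z) at_top"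
      using \<alpha>_pos assms(2) \<theta> G b by (intro multinomial_ML_limit_chord_increment) auto
    ultimately show ?thesis
      by (intro Lim_norm_ubound) auto
  qed
  ultimately show ?thesis by blast
qed

end
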